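(* Let $\mathcal{G}_c$ be the class of connected graphs. Then $d_4(\mathcal{G}_c)\leq \frac{3}{16}$.
   Context: All graphs are finite and simple. For a connected graph $G$, $\ell(G)$ is the length (number of edges) of a longest path in $G$, and $\mathcal{L}(G)$ is the set of all longest paths of $G$, i.e. all paths $P$ in $G$ with $|V(P)|=\ell(G)+1$ (a path is regarded as a subgraph). $d_G(x,y)$ is the usual graph distance, and for $U\subseteq V(G)$, $d_G(x,U)=\min\{d_G(x,y) : y\in U\}$. For $\mathcal{P}\subseteq\mathcal{L}(G)$, the path-distance-function is $$f(G,\mathcal{P})=\min\Big\{\sum_{P\in\mathcal{P}} d_G(v,V(P)) : v\in V(G)\Big\}.$$ For a class of graphs $\mathcal{G}$ and an integer $k$, the path-distance-ratio is $$d_k(\mathcal{G})=\sup \frac{f(G,\mathcal{P})}{|V(G)|},$$ where the supremum is over all graphs $G\in\mathcal{G}$ and all sets $\mathcal{P}\subseteq\mathcal{L}(G)$ with $|\mathcal{P}|=k$. *)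

theory Defs
  imports "Graph_Theory.Graph_Theory" "HOL-Library.Extended_Real"
begin

text \<open>
  A finite simple graph is a \<^locale>\<open>pair_graph\<close>: a finite vertex set with a symmetric,
  irreflexive set of arcs, each edge being represented by its two opposite arcs.
\<close>

definition connected_graphs :: "'a pair_pre_digraph set" where
  "connected_graphs = {G. pair_graph G \<and> connected (with_proj G)}"

text \<open>
  Paths are subgraphs, not vertex sequences, so that a path and its reversal coincide,
  while two paths with the same vertices and different edges are distinct.
\<close>

definition path_subgraph :: "'a vwalk \<Rightarrow> 'a pair_pre_digraph" where
  "path_subgraph p =
     \<lparr> pverts = set p, parcs = set (vwalk_arcs p) \<union> (set (vwalk_arcs p))\<inverse> \<rparr>"

definition paths :: "'a pair_pre_digraph \<Rightarrow> 'a pair_pre_digraph set" where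
  "paths G = path_subgraph ` {p. vpath p (with_proj G)}"

definition longest_path_length :: "'a pair_pre_digraph \<Rightarrow> nat" where
  "longest_path_length G = Max {vwalk_length p |p. vpath p (with_proj G)}"

definition longest_paths :: "'a pair_pre_digraph \<Rightarrow> 'a pair_pre_digraph set" where
  "longest_paths G = {P \<in> paths G. card (pverts P) = longest_path_length G + 1}"

text \<open>Meaningful only if \<open>y\<close> is reachable from \<open>x\<close>, which holds in connected graphs.\<close>

definition gdist :: "'a pair_pre_digraph \<Rightarrow> 'a \<Rightarrow> 'a \<Rightarrow> nat" where
  "gdist G x y =
     (LEAST n. \<exists>p. vwalk p (with_proj G) \<and> hd p = x \<and> last p = y \<and> vwalk_length p = n)"

definition gdist_set :: "'a pair_pre_digraph \<Rightarrow> 'a \<Rightarrow> 'a set \<Rightarrow> nat" where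
  "gdist_set G x U = Min (gdist G x ` U)"

definition path_distance :: "'a pair_pre_digraph \<Rightarrow> 'a pair_pre_digraph set \<Rightarrow> nat" where
  "path_distance G \<P> = Min ((\<lambda>v. \<Sum>P\<in>\<P>. gdist_set G v (pverts P)) ` pverts G)"

text \<open>
  The supremum is taken in \<^typ>\<open>ereal\<close>, where it always exists. It ranges over the graphs with
  vertices in the type \<^typ>\<open>'a\<close>; every finite graph occurs up to isomorphism once \<^typ>\<open>'a\<close> is
  infinite.
\<close>

definition path_distance_ratio :: "nat \<Rightarrow> 'a pair_pre_digraph set \<Rightarrow> ereal" where
  "path_distance_ratio k \<G> =
     (SUP (G, \<P>) \<in> {(G, \<P>). G \<in> \<G> \<and> \<P> \<subseteq> longest_paths G \<and> card \<P> = k}.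
        ereal (real (path_distance G \<P>) / real (card (pverts G))))"

text \<open>
  The distance agrees with the library's weighted distance for unit weights.
\<close>

lemma (in pair_wf_digraph) vwalk_imp_awalk:
  assumes "vwalk p (with_proj G)"
  shows "awalk (hd p) (vwalk_arcs p) (last p)"
  using assms
  by (induct p rule: vwalk_induct) (auto simp: awalk_Nil_iff awalk_Cons_iff dest: in_arcsD1)

lemma (in wf_digraph) awalk_cost_unit: "awalk_cost (\<lambda>_. 1) p = real (length p)"
  by (induct p) auto

lemma (in pair_graph) gdist_eq_\<mu>:
  assumes "x \<rightarrow>\<^sup>*\<^bsub>with_proj G\<^esub> y"
  shows "ereal (real (gdist G x y)) = \<mu> (\<lambda>_. 1) x y"
proof -
  obtain p where p: "awalk x p y" and \<mu>: "\<mu> (\<lambda>_. 1) x y = awalk_cost (\<lambda>_. 1) p"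
    using min_cost_awalk[OF assms, of "\<lambda>_. 1"] by (auto dest: awalkI_apath)
  have min: "length p \<le> length q" if "awalk x q y" for q
    using min_cost_le_walk_cost[OF that, of "\<lambda>_. 1"] by (simp add: \<mu> awalk_cost_unit)
  have "gdist G x y = length p"
    unfolding gdist_def
  proof (rule Least_equality)
    have "hd (awalk_verts x p) = x" "last (awalk_verts x p) = y"
      using p by (cases p; auto simp: awalk_def)+
    moreover have "vwalk_length (awalk_verts x p) = length p"
      using length_awalk_verts[of x p] by simp
    ultimately show "\<exists>q. vwalk q (with_proj G) \<and> hd q = x \<and> last q = y \<and> vwalk_length q = length p"
      using awalk_imp_vwalk[OF p] by blast
  next
    fix n assume "\<exists>q. vwalk q (with_proj G) \<and> hd q = x \<and> last q = y \<and> vwalk_length q = n"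
    then obtain q where q: "vwalk q (with_proj G)" "hd q = x" "last q = y" "vwalk_length q = n"
      by blast
    show "length p \<le> n"
      using min vwalk_imp_awalk[OF q(1)] q by (metis vwalk_length_def)
  qed
  then show ?thesis by (simp add: \<mu> awalk_cost_unit)
qed

end

theory Submission
  imports Defs
begin

text \<open>
  Let every longest path have \<open>L\<close> vertices and let \<open>D\<close> be the path distance of four of them.
  If \<open>D > 0\<close>, no vertex lies on all four, so double counting gives \<open>4 L \<le> 3 n\<close>, and it remains
  to see \<open>4 D \<le> L\<close>. Fix one path \<open>P\<close>. An initial or final part of \<open>P\<close> avoiding another longest
  path \<open>Q\<close> spans less than half of \<open>P\<close>, since it could be prolonged by the longer half of \<open>Q\<close>.
  Hence \<open>Q\<close> meets \<open>P\<close> on both sides of the centre of \<open>P\<close>. Moreover, a part of \<open>P\<close> joining two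
  vertices of \<open>Q\<close> and otherwise avoiding \<open>Q\<close> closes a cycle with \<open>Q\<close>, and rerouting \<open>Q\<close> along it
  shows that consecutive meeting points are at most \<open>(L + 1) / 3\<close> apart. So the centre lies in
  three intervals of length at most \<open>g = (L + 1) / 3\<close>, one for each other path, whose ends are
  meeting points. Three segments of \<open>P\<close>, each containing an end of every interval, have total
  length at most \<open>2 g\<close>; the middle of the three ends in the shortest segment yields
  \<open>3 D \<le> 2 g\<close>, hence \<open>9 D \<le> 2 (L + 1)\<close>, and \<open>4 D \<le> L\<close> by integrality.
\<close>

section \<open>Rerouting longest paths, with paths as vertex lists\<close>

definition simple_path :: "('a \<Rightarrow> 'a \<Rightarrow> bool) \<Rightarrow> 'a list \<Rightarrow> bool" where
  "simple_path E xs \<longleftrightarrow> distinct xs \<and> successively E xs"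

text \<open>\<open>L\<close> counts vertices, not edges; longest paths are represented by simple
  paths of length exactly \<open>L\<close>.\<close>

locale path_bound =
  fixes E :: "'a \<Rightarrow> 'a \<Rightarrow> bool" and L :: nat
  assumes sym: "E x y \<Longrightarrow> E y x"
    and bound: "simple_path E xs \<Longrightarrow> length xs \<le> L"
begin

lemma adj_commute: "E x y \<longleftrightarrow> E y x"
  using sym by blast

declare successively_rev [simp del]

text \<open>The general rule flips the relation; symmetry keeps \<open>E\<close>, so reversed pieces
  of paths can be recombined freely.\<close>

lemma successively_rev_adj [simp]: "successively E (rev xs) = successively E xs"
proof -
  have "(\<lambda>x y. E y x) = E" using sym by blast
  then show ?thesis by (simp only: successively_rev)
qed

lemma simple_path_rev [simp]: "simple_path E (rev xs) = simple_path E xs"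
  by (simp add: simple_path_def)

lemmas path_simps = simple_path_def successively_append_iff successively_Cons
  hd_append last_rev hd_rev

text \<open>Prolonging \<open>zs\<close> through \<open>y\<close> by \<open>B\<close> or by
  \<open>rev A\<close> shows that \<open>zs\<close> is at most as long as \<open>A\<close> and as
  \<open>B\<close>; add the two bounds.\<close>

lemma tail_bound:
  assumes "simple_path E (A @ [y] @ B)" "length (A @ [y] @ B) = L"
    and "simple_path E (zs @ [y])" "set zs \<inter> set (A @ [y] @ B) = {}"
  shows "2 * length zs + 1 \<le> L"
proof -
  have "simple_path E (zs @ [y] @ B)" "simple_path E (zs @ [y] @ rev A)"
    using assms by (auto simp: path_simps adj_commute split: if_splits)
  from this[THEN bound] assms(2) show ?thesis by simp
qed

text \<open>The three reroutings give up \<open>H\<close>, \<open>B\<close> and \<open>A\<close> in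
  turn in favour of \<open>zs\<close>. So \<open>zs\<close> is at most as long as each of them, and
  their lengths sum to \<open>L - 2\<close>.\<close>

lemma gap_bound_aux:
  assumes "simple_path E (A @ [y] @ H @ [y'] @ B)" "length (A @ [y] @ H @ [y'] @ B) = L"
    and "simple_path E ([y] @ zs @ [y'])" "set zs \<inter> set (A @ [y] @ H @ [y'] @ B) = {}"
  shows "3 * length zs + 2 \<le> L"
proof -
  have "simple_path E (A @ [y] @ zs @ [y'] @ B)"
    using assms by (auto simp: path_simps adj_commute split: if_splits)
  moreover have "simple_path E (A @ [y] @ H @ [y'] @ rev zs)"
    using assms by (auto simp: path_simps adj_commute split: if_splits)
  moreover have "simple_path E (rev B @ [y'] @ rev H @ [y] @ zs)"
    using assms by (auto simp: path_simps adj_commute split: if_splits)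
  ultimately show ?thesis using assms(2) by (auto dest!: bound)
qed

lemma gap_bound:
  assumes "simple_path E ys" "length ys = L" "y \<in> set ys" "y' \<in> set ys" "y \<noteq> y'"
    and "simple_path E ([y] @ zs @ [y'])" "set zs \<inter> set ys = {}"
  shows "3 * length zs + 2 \<le> L"
proof -
  obtain A C where ys: "ys = A @ y # C" using assms(3) by (meson split_list)
  consider "y' \<in> set C" | "y' \<in> set A" using assms(4,5) ys by auto
  then show ?thesis
  proof cases
    case 1
    then obtain H B where "C = H @ y' # B" by (meson split_list)
    with ys assms show ?thesis by (intro gap_bound_aux[of A y H y' B zs]) auto
  next
    case 2
    then obtain H B where "A = H @ y' # B" by (meson split_list)
    moreover have "simple_path E (rev ([y] @ zs @ [y']))" using assms(6) by (simp only: simple_path_rev)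
    ultimately show ?thesis using ys assms gap_bound_aux[of H y' B y C "rev zs"] by auto
  qed
qed

text \<open>If the two were disjoint, a segment \<open>a # M @ [b]\<close> of \<open>w\<close> would
  join them with \<open>M\<close> off both. The two paths below use every vertex of
  \<open>xs\<close> and \<open>ys\<close>, and both \<open>a\<close> and \<open>b\<close> twice, so
  their lengths sum to at least \<open>2 * L + 2\<close>.\<close>

lemma longest_intersect:
  assumes "simple_path E xs" "length xs = L" "simple_path E ys" "length ys = L"
    and "simple_path E w" "w \<noteq> []" "hd w \<in> set xs" "last w \<in> set ys"
  shows "set xs \<inter> set ys \<noteq> {}"
proof
  assume disj: "set xs \<inter> set ys = {}"
  have "\<exists>x\<in>set w. x \<in> set xs" using assms(6,7) hd_in_set by blast
  then obtain w1 a w2 where w: "w = w1 @ a # w2" "a \<in> set xs" "\<forall>z\<in>set w2. z \<notin> set xs"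
    using split_list_last_propE[of w "\<lambda>x. x \<in> set xs"] by metis
  have "a \<notin> set ys" using w disj by blast
  then have "last w \<noteq> a" "w2 \<noteq> []" using assms(8) w by auto
  then have "\<exists>x\<in>set w2. x \<in> set ys" using assms(8) w(1) last_in_set[of w2] by auto
  then obtain M b w3 where w2: "w2 = M @ b # w3" "b \<in> set ys" "\<forall>z\<in>set M. z \<notin> set ys"
    using split_list_first_propE[of w2 "\<lambda>x. x \<in> set ys"] by metis
  obtain A B where xs: "xs = A @ a # B" using w(2) by (meson split_list)
  obtain C D where ys: "ys = C @ b # D" using w2(2) by (meson split_list)
  have M: "simple_path E (a # M @ [b])" using assms(5) w w2
    by (auto simp: path_simps split: if_splits)
  have "simple_path E (A @ [a] @ M @ [b] @ rev C)"
    using assms(1,3) M xs ys disj w w2 by (auto simp: path_simps adj_commute split: if_splits)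
  moreover have "simple_path E (rev B @ [a] @ M @ [b] @ D)"
    using assms(1,3) M xs ys disj w w2 by (auto simp: path_simps adj_commute split: if_splits)
  ultimately show False using assms(2,4) xs ys by (auto dest!: bound)
qed

lemma simple_path_sub:
  assumes "simple_path E (A @ B @ C)"
  shows "simple_path E B"
  using assms by (auto simp: simple_path_def successively_append_iff)

lemma first_hit_bound:
  assumes xs: "simple_path E xs" "length xs = L" and ys: "simple_path E ys" "length ys = L"
    and "set xs \<inter> set ys \<noteq> {}"
  obtains i where "2 * i < L" "xs ! i \<in> set ys"
proof -
  have "\<exists>x\<in>set xs. x \<in> set ys" using assms(5) by blast
  then obtain zs y R where x: "xs = zs @ y # R" "y \<in> set ys" "\<forall>z\<in>set zs. z \<notin> set ys"
    using split_list_first_propE[of xs "\<lambda>x. x \<in> set ys"] by metis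
  obtain A B where "ys = A @ y # B" using x(2) by (meson split_list)
  moreover have "simple_path E (zs @ [y])" using xs(1) x(1) simple_path_sub[of "[]" "zs @ [y]" R] by simp
  ultimately have "2 * length zs + 1 \<le> L" using tail_bound[of A y B zs] ys x(3) by auto
  then show ?thesis using x(1,2) that[of "length zs"] by simp
qed

lemma hits_around_centre:
  assumes xs: "simple_path E xs" "length xs = L" and ys: "simple_path E ys" "length ys = L"
    and meet: "set xs \<inter> set ys \<noteq> {}"
  obtains i k where "i \<le> (L - 1) div 2" "(L - 1) div 2 \<le> k" "k < L"
    "xs ! i \<in> set ys" "xs ! k \<in> set ys" "3 * (k - i) \<le> L + 1"
proof -
  define c where "c = (L - 1) div 2"
  define hit where "hit i \<longleftrightarrow> xs ! i \<in> set ys" for i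
  obtain i0 where i0: "2 * i0 < L" "hit i0"
    using first_hit_bound[OF assms] unfolding hit_def by blast
  obtain j where j: "2 * j < L" "rev xs ! j \<in> set ys"
    using first_hit_bound[of "rev xs" ys] assms by auto
  \<comment> \<open>A hit in the first half of \<open>rev xs\<close> is a hit of \<open>xs\<close>
    at or after the centre.\<close>
  define k0 where "k0 = L - 1 - j"
  have k0: "hit k0" "c \<le> k0" "k0 < L"
    using j xs by (auto simp: hit_def k0_def c_def rev_nth)
  have "i0 \<le> c" using i0 by (simp add: c_def)
  \<comment> \<open>\<open>i\<close> and \<open>k\<close> will be the meeting positions nearest to
    the centre on either side, so no position strictly between them is a hit. They coincide when the
    centre is a hit.\<close>
  define i where "i = (GREATEST i. i \<le> c \<and> hit i)"
  have i: "i \<le> c \<and> hit i" unfolding i_def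
    by (rule GreatestI_nat[of _ i0 c]) (use i0 \<open>i0 \<le> c\<close> in auto)
  have i_max: "m \<le> i" if "m \<le> c" "hit m" for m unfolding i_def
    by (rule Greatest_le_nat[of _ m c]) (use that in auto)
  define k where "k = (LEAST k. c \<le> k \<and> hit k)"
  have k: "c \<le> k \<and> hit k" unfolding k_def
    by (rule LeastI[of _ k0]) (use k0 in auto)
  have k_min: "k \<le> m" if "c \<le> m" "hit m" for m unfolding k_def
    by (rule Least_le) (use that in auto)
  have "k < L" using k_min[of k0] k0 by simp
  have "3 * (k - i) \<le> L + 1"
  proof (cases "i < k")
    case False
    then show ?thesis by simp
  next
    case True
    define zs where "zs = take (k - i - 1) (drop (Suc i) xs)"
    have len: "length zs = k - i - 1" using \<open>k < L\<close> xs by (simp add: zs_def)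
    have split: "xs = take i xs @ ([xs ! i] @ zs @ [xs ! k]) @ drop (Suc k) xs"
    proof -
      have "drop (Suc i) xs = zs @ drop (k - i - 1) (drop (Suc i) xs)"
        unfolding zs_def by (simp only: append_take_drop_id)
      also have "drop (k - i - 1) (drop (Suc i) xs) = drop k xs" using True by simp
      also have "\<dots> = xs ! k # drop (Suc k) xs" using \<open>k < L\<close> xs by (simp add: Cons_nth_drop_Suc)
      finally show ?thesis using id_take_nth_drop[of i xs] True \<open>k < L\<close> xs by simp
    qed
    have "simple_path E ([xs ! i] @ zs @ [xs ! k])"
      using simple_path_sub split xs(1) by metis
    moreover have "set zs \<inter> set ys = {}"
    proof (rule ccontr)
      assume "set zs \<inter> set ys \<noteq> {}"
      then obtain n where n: "n < length zs" "zs ! n \<in> set ys"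
        by (metis disjoint_iff in_set_conv_nth)
      then have "hit (Suc i + n)" using \<open>k < L\<close> xs by (simp add: hit_def zs_def)
      with n len i_max[of "Suc i + n"] k_min[of "Suc i + n"] show False by linarith
    qed
    moreover have "xs ! i \<noteq> xs ! k"
      using True \<open>k < L\<close> xs by (simp add: simple_path_def nth_eq_iff_index_eq)
    ultimately have "3 * length zs + 2 \<le> L"
      using gap_bound[OF ys, of "xs ! i" "xs ! k" zs] i k by (simp add: hit_def)
    then show ?thesis using len True by linarith
  qed
  then show ?thesis using that i k \<open>k < L\<close> unfolding c_def hit_def by blast
qed

end

section \<open>A position close to three intervals with a common centre\<close>

lemma exists_good_position:
  fixes f :: "'i \<Rightarrow> nat \<Rightarrow> int" and i k :: "'i \<Rightarrow> nat"
  assumes ik: "\<And>j. j \<in> {p, q, r} \<Longrightarrow> i j \<le> c \<and> c \<le> k j \<and> k j \<le> i j + g \<and> k j < L"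
    and f: "\<And>j m. j \<in> {p, q, r} \<Longrightarrow> m < L \<Longrightarrow>
      f j m \<le> \<bar>int m - int (i j)\<bar> \<and> f j m \<le> \<bar>int m - int (k j)\<bar>"
  shows "\<exists>m<L. 3 * (f p m + f q m + f r m) \<le> 2 * int g"
proof -
  \<comment> \<open>Only the order of the left ends matters: all intervals contain \<open>c\<close>,
    so every left end is at most every right end.\<close>
  have sorted: "\<exists>m<L. 3 * (f a m + f b m + f d m) \<le> 2 * int g"
    if abd: "{a, b, d} = {p, q, r}" and ord: "i a \<ge> i b" "i b \<ge> i d" for a b d
  proof -
    \<comment> \<open>Since \<open>i d \<le> i b\<close>, both \<open>k b\<close> and
      \<open>k d\<close> are at most \<open>i b + g\<close>; the smaller of them is the middle one
      of \<open>i a\<close>, \<open>k b\<close>, \<open>k d\<close>.\<close>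
    define n where "n = min (k b) (k d)"
    have in_pqr: "a \<in> {p, q, r}" "b \<in> {p, q, r}" "d \<in> {p, q, r}" using abd by blast+
    note ab = ik[OF in_pqr(1)] ik[OF in_pqr(2)] ik[OF in_pqr(3)]
    have L: "i b < L" "i a < L" "n < L" using ab by (auto simp: n_def)
    note fs = f[OF in_pqr(1)] f[OF in_pqr(2)] f[OF in_pqr(3)]
    \<comment> \<open>Evaluate at the middle of \<open>i d \<le> i b \<le> i a\<close>, of \<open>i b \<le> i a \<le> k d\<close>, and of \<open>i a\<close>, \<open>k b\<close>, \<open>k d\<close>;
      the three bounds add up to \<open>2 g\<close>.\<close>
    have 1: "f a (i b) + f b (i b) + f d (i b) \<le> int (i a) - int (i d)"
      using fs[OF L(1)] ord by linarith
    have 2: "f a (i a) + f b (i a) + f d (i a) \<le> int (i d) + g - int (i b)"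
      using fs[OF L(2)] ord ab by linarith
    have 3: "f a n + f b n + f d n \<le> int (i b) + g - int (i a)"
    proof (cases "k b \<le> k d")
      case True
      then have "n = k b" by (simp add: n_def)
      with True fs[OF L(3)] ord ab show ?thesis by linarith
    next
      case False
      then have "n = k d" by (simp add: n_def)
      with False fs[OF L(3)] ord ab show ?thesis by linarith
    qed
    show ?thesis
    proof (rule ccontr)
      assume "\<not> ?thesis"
      then have less: "2 * int g < 3 * (f a m + f b m + f d m)" if "m < L" for m
        using that by (meson not_le)
      have "6 * int g < 3 * (f a (i b) + f b (i b) + f d (i b))
          + 3 * (f a (i a) + f b (i a) + f d (i a)) + 3 * (f a n + f b n + f d n)"
        using less[OF L(1)] less[OF L(2)] less[OF L(3)] by linarith
      also have "\<dots> \<le> 3 * (int (i a) - int (i d)) + 3 * (int (i d) + g - int (i b))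
          + 3 * (int (i b) + g - int (i a))"
        using 1 2 3 by (intro add_mono mult_left_mono) auto
      finally show False by simp
    qed
  qed
  have "i p \<ge> i q \<and> i q \<ge> i r \<or> i p \<ge> i r \<and> i r \<ge> i q \<or> i q \<ge> i p \<and> i p \<ge> i r \<or>
    i q \<ge> i r \<and> i r \<ge> i p \<or> i r \<ge> i p \<and> i p \<ge> i q \<or> i r \<ge> i q \<and> i q \<ge> i p" by linarith
  then show ?thesis
    using sorted[of p q r] sorted[of p r q] sorted[of q p r] sorted[of q r p]
      sorted[of r p q] sorted[of r q p]
    by (auto simp: insert_commute add_ac)
qed

section \<open>Walks, longest paths and distances of a graph in terms of vertex lists\<close>

lemma successively_iff_vwalk_arcs:
  "successively (\<lambda>x y. (x, y) \<in> R) xs \<longleftrightarrow> set (vwalk_arcs xs) \<subseteq> R"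
  by (induction xs rule: vwalk_arcs.induct) auto

context pair_graph
begin

abbreviation adj :: "'a \<Rightarrow> 'a \<Rightarrow> bool" where
  "adj x y \<equiv> (x, y) \<in> parcs G"

lemma vwalk_iff:
  "vwalk xs (with_proj G) \<longleftrightarrow> xs \<noteq> [] \<and> set xs \<subseteq> pverts G \<and> successively adj xs"
  by (auto simp: vwalk_def successively_iff_vwalk_arcs)

lemma vpath_iff:
  "vpath xs (with_proj G) \<longleftrightarrow> xs \<noteq> [] \<and> set xs \<subseteq> pverts G \<and> simple_path adj xs"
  by (auto simp: vpath_def vwalk_iff simple_path_def)

text \<open>A one-entry list has no arcs that would force its entry into the graph.\<close>

lemma successively_adj_verts:
  assumes "successively adj xs" "length xs \<noteq> 1"
  shows "set xs \<subseteq> pverts G"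
  using assms
proof (induction xs rule: vwalk_arcs.induct)
  case (3 x y xs)
  then show ?case by (cases xs) (auto dest: in_arcsD1 in_arcsD2)
qed auto

lemma finite_vpath_lengths: "finite {vwalk_length p |p. vpath p (with_proj G)}"
proof -
  have "{vwalk_length p |p. vpath p (with_proj G)} \<subseteq> {..card (pverts G)}"
  proof clarsimp
    fix p assume "vpath p (with_proj G)"
    then have "distinct p" "set p \<subseteq> pverts G" by (auto simp: vpath_iff simple_path_def)
    then have "length p \<le> card (pverts G)"
      by (metis card_mono distinct_card pair_finite_verts)
    then show "length p - Suc 0 \<le> card (pverts G)" by simp
  qed
  then show ?thesis by (rule finite_subset) simp
qed

text \<open>The \<open>+ 1\<close> passes from edges to vertices; it also covers one-entry lists
  whose entry lies outside the graph.\<close>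

lemma path_bound: "path_bound adj (longest_path_length G + 1)"
proof
  show "adj y x" if "adj x y" for x y
    using that pair_sym_arcs by (auto simp: symmetric_def dest: symD)
next
  fix xs assume xs: "simple_path adj xs"
  show "length xs \<le> longest_path_length G + 1"
  proof (cases "length xs \<le> 1")
    case False
    then have "vpath xs (with_proj G)"
      using xs successively_adj_verts[of xs] by (auto simp: vpath_iff simple_path_def)
    then have "vwalk_length xs \<le> longest_path_length G"
      unfolding longest_path_length_def by (intro Max_ge finite_vpath_lengths) blast
    then show ?thesis by simp
  qed auto
qed

lemma longest_pathsE:
  assumes "P \<in> longest_paths G"
  obtains xs where "pverts P = set xs" "simple_path adj xs" "set xs \<subseteq> pverts G"
    "length xs = longest_path_length G + 1"
proof -
  obtain xs where "P = path_subgraph xs" "vpath xs (with_proj G)"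
      "card (pverts P) = longest_path_length G + 1"
    using assms by (auto simp: longest_paths_def paths_def)
  then show ?thesis
    using that[of xs] by (auto simp: path_subgraph_def vpath_iff simple_path_def distinct_card)
qed

lemma gdist_set_le:
  assumes "vwalk p (with_proj G)" "hd p = x" "last p \<in> U" "finite U"
  shows "gdist_set G x U \<le> length p - 1"
proof -
  have "gdist_set G x U \<le> gdist G x (last p)"
    using assms unfolding gdist_set_def by (intro Min_le) auto
  also have "\<dots> \<le> length p - 1"
    unfolding gdist_def by (rule Least_le) (use assms in auto)
  finally show ?thesis .
qed

text \<open>The part of the path between the two positions, reversed if necessary, is a walk to
  \<open>U\<close>.\<close>

lemma gdist_set_le_index_diff:
  assumes xs: "simple_path adj xs" "set xs \<subseteq> pverts G"
    and mi: "m < length xs" "i < length xs" "xs ! i \<in> U" and "finite U"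
  shows "int (gdist_set G (xs ! m) U) \<le> \<bar>int m - int i\<bar>"
proof -
  interpret path_bound adj "longest_path_length G + 1" by (rule path_bound)
  define seg where "seg a b = take (Suc b - a) (drop a xs)" for a b
  have seg: "vwalk (seg a b) (with_proj G)" "hd (seg a b) = xs ! a" "last (seg a b) = xs ! b"
      "length (seg a b) = Suc b - a" if "a \<le> b" "b < length xs" for a b
  proof -
    have "xs = take a xs @ seg a b @ drop (Suc b - a) (drop a xs)"
      unfolding seg_def by (simp only: append_take_drop_id)
    then have "simple_path adj (seg a b)" using simple_path_sub xs(1) by metis
    moreover show len: "length (seg a b) = Suc b - a" using that by (simp add: seg_def)
    moreover from len that have "seg a b \<noteq> []" by auto
    moreover have "set (seg a b) \<subseteq> pverts G"
      using xs(2) by (auto simp: seg_def dest!: in_set_takeD in_set_dropD)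
    ultimately show "vwalk (seg a b) (with_proj G)" by (simp add: vwalk_iff simple_path_def)
    show "hd (seg a b) = xs ! a" using that by (simp add: seg_def hd_drop_conv_nth)
    show "last (seg a b) = xs ! b"
      using that \<open>seg a b \<noteq> []\<close> len by (simp add: last_conv_nth) (simp add: seg_def)
  qed
  show ?thesis
  proof (cases "m \<le> i")
    case True
    with seg[of m i] mi \<open>finite U\<close> gdist_set_le[of "seg m i" "xs ! m" U] show ?thesis by auto
  next
    case False
    then have "vwalk (rev (seg i m)) (with_proj G)" "hd (rev (seg i m)) = xs ! m"
        "last (rev (seg i m)) = xs ! i" "length (rev (seg i m)) = Suc m - i"
      using seg[of i m] mi by (auto simp: vwalk_iff hd_rev last_rev)
    with False mi \<open>finite U\<close> gdist_set_le[of "rev (seg i m)" "xs ! m" U] show ?thesis by auto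
  qed
qed

lemma gdist_set_self:
  assumes "v \<in> U" "v \<in> pverts G" "finite U"
  shows "gdist_set G v U = 0"
  using gdist_set_le[of "[v]" v U] assms by (simp add: vwalk_iff)

lemma path_distance_le:
  assumes "v \<in> pverts G"
  shows "path_distance G \<P> \<le> (\<Sum>P\<in>\<P>. gdist_set G v (pverts P))"
  unfolding path_distance_def using assms pair_finite_verts by (intro Min_le) auto

section \<open>The estimates for four longest paths and the final ratio\<close>

lemma path_distance_4_le:
  assumes conn: "connected (with_proj G)" and \<P>: "\<P> \<subseteq> longest_paths G" "card \<P> = 4"
  shows "9 * path_distance G \<P> \<le> 2 * (longest_path_length G + 2)"
proof -
  define L where "L = longest_path_length G + 1"
  interpret path_bound adj L unfolding L_def by (rule path_bound)
  have "\<forall>P\<in>\<P>. \<exists>xs. pverts P = set xs \<and> simple_path adj xs \<and> set xs \<subseteq> pverts G \<and> length xs = L"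
    using \<P>(1) unfolding L_def by (metis longest_pathsE subsetD)
  then obtain W where W: "\<And>P. P \<in> \<P> \<Longrightarrow> pverts P = set (W P)"
      "\<And>P. P \<in> \<P> \<Longrightarrow> simple_path adj (W P)" "\<And>P. P \<in> \<P> \<Longrightarrow> set (W P) \<subseteq> pverts G"
      "\<And>P. P \<in> \<P> \<Longrightarrow> length (W P) = L"
    by metis
  obtain P0 P1 P2 P3 where P: "\<P> = {P0, P1, P2, P3}" "distinct [P0, P1, P2, P3]"
  proof -
    have "finite \<P>" using \<P>(2) card_ge_0_finite by force
    then obtain Ps where Ps: "set Ps = \<P>" "distinct Ps" by (metis finite_distinct_list)
    then have "length Ps = 4" using \<P>(2) distinct_card by metis
    then obtain P0 P1 P2 P3 where "Ps = [P0, P1, P2, P3]"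
      by (auto simp: numeral_eq_Suc length_Suc_conv)
    with Ps show ?thesis using that[of P0 P1 P2 P3] by simp
  qed
  \<comment> \<open>Candidate vertices are taken on \<open>P0\<close> only, where the distance to
    \<open>P0\<close> vanishes and three summands remain.\<close>
  have P0: "P0 \<in> \<P>" using P(1) by simp
  define xs where "xs = W P0"
  have xs: "simple_path adj xs" "set xs \<subseteq> pverts G" "length xs = L"
    using W(2-4)[OF P0] by (simp_all add: xs_def)
  have meet: "set xs \<inter> set (W Q) \<noteq> {}" if "Q \<in> \<P>" for Q
  proof -
    have "xs \<noteq> []" "W Q \<noteq> []" using xs(3) W(4)[OF that] by (auto simp: L_def)
    then have "hd xs \<in> pverts G" "hd (W Q) \<in> pverts G"
      using xs(2) W(3)[OF that] hd_in_set by blast+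
    \<comment> \<open>\<open>connected\<close> speaks of the symmetric closure; as the arcs are
      symmetric already, directed reachability follows.\<close>
    moreover have "strongly_connected (with_proj G)"
      using conn by (rule symmetric_connected_imp_strongly_connected[rotated]) (rule pair_sym_arcs)
    ultimately have "hd xs \<rightarrow>\<^sup>*\<^bsub>with_proj G\<^esub> hd (W Q)" by (auto simp: strongly_connected_def)
    then obtain w where "vpath w (with_proj G)" "hd w = hd xs" "last w = hd (W Q)"
      by (auto simp: reachable_vpath_conv)
    then show ?thesis
      using longest_intersect[of xs "W Q" w] xs W(2,4)[OF that] \<open>xs \<noteq> []\<close> \<open>W Q \<noteq> []\<close>
      by (auto simp: vpath_iff)
  qed
  define c where "c = (L - 1) div 2"
  have "\<forall>Q\<in>\<P>. \<exists>i k. i \<le> c \<and> c \<le> k \<and> k < L \<and> xs ! i \<in> set (W Q) \<and> xs ! k \<in> set (W Q)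
      \<and> 3 * (k - i) \<le> L + 1"
    using hits_around_centre[OF xs(1,3) W(2,4) meet] unfolding c_def by metis
  then obtain i k where ik: "\<And>Q. Q \<in> \<P> \<Longrightarrow> i Q \<le> c \<and> c \<le> k Q \<and> k Q < L \<and>
      xs ! i Q \<in> set (W Q) \<and> xs ! k Q \<in> set (W Q) \<and> 3 * (k Q - i Q) \<le> L + 1"
    by metis
  define f where "f Q m = int (gdist_set G (xs ! m) (pverts Q))"
    for Q :: "'a pair_pre_digraph" and m
  \<comment> \<open>Interval lengths are integers, so rounding down keeps them at most
    \<open>g\<close>.\<close>
  define g where "g = (L + 1) div 3"
  have "\<exists>m<L. 3 * (f P1 m + f P2 m + f P3 m) \<le> 2 * int g"
  proof (rule exists_good_position[where i = i and k = k and c = c])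
    fix Q assume "Q \<in> {P1, P2, P3}"
    then have Q: "Q \<in> \<P>" using P by auto
    show "i Q \<le> c \<and> c \<le> k Q \<and> k Q \<le> i Q + g \<and> k Q < L"
      using ik[OF Q] unfolding g_def by linarith
    fix m assume "m < L"
    then show "f Q m \<le> \<bar>int m - int (i Q)\<bar> \<and> f Q m \<le> \<bar>int m - int (k Q)\<bar>"
      using gdist_set_le_index_diff[OF xs(1,2), of m] ik[OF Q] W(1)[OF Q] xs(3)
      unfolding f_def by force
  qed
  then obtain m where m: "m < L" "3 * (f P1 m + f P2 m + f P3 m) \<le> 2 * int g" by blast
  have "xs ! m \<in> set xs" using m xs by simp
  then have "f P0 m = 0" using gdist_set_self[of "xs ! m" "set xs"] xs W(1)[OF P0]
    by (auto simp: f_def xs_def)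
  moreover have "path_distance G \<P> \<le> (\<Sum>P\<in>\<P>. gdist_set G (xs ! m) (pverts P))"
    using path_distance_le \<open>xs ! m \<in> set xs\<close> xs(2) by blast
  then have "int (path_distance G \<P>) \<le> f P0 m + f P1 m + f P2 m + f P3 m"
    using P by (simp add: f_def)
  ultimately have "3 * int (path_distance G \<P>) \<le> 3 * (f P1 m + f P2 m + f P3 m)" by simp
  also note m(2)
  finally have "3 * int (path_distance G \<P>) \<le> 2 * int g" .
  then have "9 * int (path_distance G \<P>) \<le> 2 * int (3 * g)" by simp
  also have "3 * g \<le> L + 1" by (simp add: g_def)
  finally show ?thesis by (simp add: L_def)
qed

text \<open>Count incidences of vertices with paths: a vertex on all \<open>Suc k\<close> paths
  would have distance sum 0, so each vertex lies on at most \<open>k\<close>.\<close>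

lemma card_longest_paths_le:
  assumes \<P>: "\<P> \<subseteq> longest_paths G" "card \<P> = Suc k" and pos: "0 < path_distance G \<P>"
  shows "Suc k * (longest_path_length G + 1) \<le> k * card (pverts G)"
proof -
  have fin: "finite \<P>" using \<P>(2) card_ge_0_finite by force
  have sub: "pverts P \<subseteq> pverts G" if "P \<in> \<P>" for P
    using that \<P>(1) by (metis longest_pathsE subsetD)
  have "Suc k * (longest_path_length G + 1) = (\<Sum>P\<in>\<P>. card (pverts P))"
    using \<P> by (subst sum.cong[OF refl, of _ _ "\<lambda>_. longest_path_length G + 1"])
      (auto simp: longest_paths_def)
  also have "\<dots> = (\<Sum>P\<in>\<P>. \<Sum>v\<in>pverts G. of_bool (v \<in> pverts P))"
    using sub by (intro sum.cong refl) (simp add: pair_finite_verts Int_absorb1)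
  also have "\<dots> = (\<Sum>v\<in>pverts G. card {P\<in>\<P>. v \<in> pverts P})"
    using fin by (subst sum.swap) (simp add: Int_def)
  also have "\<dots> \<le> (\<Sum>v\<in>pverts G. k)"
  proof (rule sum_mono)
    fix v assume v: "v \<in> pverts G"
    have "\<not> \<P> \<subseteq> {P\<in>\<P>. v \<in> pverts P}"
    proof
      assume all: "\<P> \<subseteq> {P\<in>\<P>. v \<in> pverts P}"
      have "(\<Sum>P\<in>\<P>. gdist_set G v (pverts P)) = 0"
        using all v finite_subset[OF sub pair_finite_verts]
        by (intro sum.neutral ballI gdist_set_self) auto
      with path_distance_le[OF v, of \<P>] pos show False by simp
    qed
    then have "card {P\<in>\<P>. v \<in> pverts P} < card \<P>" using fin by (intro psubset_card_mono) auto
    then show "card {P\<in>\<P>. v \<in> pverts P} \<le> k" using \<P>(2) by simp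
  qed
  finally show ?thesis by (simp add: mult.commute)
qed

end

theorem theorem3:
  shows "path_distance_ratio 4 (connected_graphs :: 'a pair_pre_digraph set) \<le> 3 / 16"
proof -
  have main: "ereal (real (path_distance G \<P>) / real (card (pverts G))) \<le> 3 / 16"
    if G: "G \<in> connected_graphs" and \<P>: "\<P> \<subseteq> longest_paths G" "card \<P> = 4"
    for G :: "'a pair_pre_digraph" and \<P>
  proof -
    interpret pair_graph G using G by (simp add: connected_graphs_def)
    have conn: "connected (with_proj G)" using G by (simp add: connected_graphs_def)
    have "16 * path_distance G \<P> \<le> 3 * card (pverts G)"
    proof (cases "path_distance G \<P> = 0")
      case False
      \<comment> \<open>Otherwise \<open>l + 2 \<le> 4 * d\<close>, so
        \<open>9 * d \<le> 8 * d\<close> and \<open>d = 0\<close>.\<close>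
      have "4 * d \<le> l + 1" if "9 * d \<le> 2 * (l + 2)" "d \<noteq> 0" for d l :: nat
        using that by presburger
      from this[OF path_distance_4_le[OF conn \<P>] False]
      have "4 * (4 * path_distance G \<P>) \<le> 4 * (longest_path_length G + 1)"
        by (rule mult_le_mono2)
      also have "\<dots> \<le> 3 * card (pverts G)"
        using card_longest_paths_le[of \<P> 3] \<P> False by simp
      finally show ?thesis by simp
    qed simp
    \<comment> \<open>\<open>strongly_connected\<close> includes that the vertex set is
      nonempty.\<close>
    moreover have "0 < card (pverts G)"
      using conn by (auto simp: connected_def strongly_connected_def card_gt_0_iff pair_finite_verts)
    ultimately have "real (path_distance G \<P>) / real (card (pverts G)) \<le> 3 / 16"
      by (simp add: field_simps flip: of_nat_mult)
    then have "ereal (real (path_distance G \<P>) / real (card (pverts G))) \<le> ereal (3 / 16)"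
      by (simp only: ereal_less_eq)
    then show ?thesis by simp
  qed
  show ?thesis
    unfolding path_distance_ratio_def by (rule SUP_least) (use main in auto)
qed

end
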